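(* Let $\Delta t>0$ and $n\ge0$. Given $(u_h^n,U_h^n)\in V_h\times V_h$, consider the scheme: find $(u_h^{n+1},U_h^{n+1})\in V_h\times V_h$ such that for all $\phi,\psi\in V_h$ $$\left(\frac{u_h^{n+1}-u_h^n}{\Delta t},\phi\right)=-A(\epsilon^2;u_h^{n+1},\phi)-\left(H(u_h^n)U_h^{n+1},\phi\right),$$ $$\left(\frac{U_h^{n+1}-U_h^n}{\Delta t},\psi\right)=\left(\frac12H(u_h^n)\frac{u_h^{n+1}-u_h^n}{\Delta t},\psi\right).$$ Then the scheme admits a unique solution $(u_h^{n+1},U_h^{n+1})\in V_h\times V_h$, and it satisfies the energy dissipation law $$E(u_h^{n+1},U_h^{n+1})=E(u_h^n,U_h^n)-\frac1{\Delta t}\|u_h^{n+1}-u_h^n\|^2-\frac12A(\epsilon^2;u_h^{n+1}-u_h^n,u_h^{n+1}-u_h^n)-\|U_h^{n+1}-U_h^n\|^2.$$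
   Context: $\Omega\subset\mathbb{R}^d$ ($d=2,3$) is a bounded domain and $\epsilon>0$ is a constant. $\mathcal T$ is a quasi-uniform triangulation $\Omega=\cup_{i=1}^N T_i$, and $V_h=\{v\in C^0(\Omega)\cap H^1(\Omega): v|_{T_i}\in P_k\ \forall T_i\in\mathcal T\}$, where $P_k$ is the space of polynomials of degree at most $k$ ($k\ge1$ fixed). $C^0(\Omega)$ denotes functions continuous on $\overline\Omega$. $(\cdot,\cdot)$ and $\|\cdot\|$ are the $L^2(\Omega)$ inner product and norm. For a coefficient $a(x)$, $A(a;q,v)=\int_\Omega a(x)\nabla q\cdot\nabla v\,dx$. The potential $F$ is a $C^1$ function on an interval $I\subseteq\mathbb{R}$ (e.g. $F(u)=\frac14(u^2-1)^2$ with $I=\mathbb{R}$, or the logarithmic Flory–Huggins potential with $I=(0,1)$). The constant $B\ge0$ is such that $F+B>0$, and $H(w)=F'(w)/\sqrt{F(w)+B}$. It is a standing assumption that all functions at which $F,F',H$ are evaluated take values (on $\overline\Omega$) where these are defined and $F+B>0$. The energy is $E(v,V)=\frac12A(\epsilon^2;v,v)+\int_\Omega V^2\,dx-B|\Omega|$. *)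

theory Defs
  imports "HOL-Analysis.Analysis"
begin

section \<open>Lebesgue and Sobolev spaces\<close>

definition L2_space :: "(real ^ 'd) set \<Rightarrow> (real ^ 'd \<Rightarrow> real) set" where
  "L2_space \<Omega> = {f. f \<in> borel_measurable (lebesgue_on \<Omega>) \<and>
                    integrable (lebesgue_on \<Omega>) (\<lambda>x. (f x)\<^sup>2)}"

definition L2_inner :: "(real ^ 'd) set \<Rightarrow> (real ^ 'd \<Rightarrow> real) \<Rightarrow> (real ^ 'd \<Rightarrow> real) \<Rightarrow> real" where
  "L2_inner \<Omega> f g = (\<integral>x. f x * g x \<partial>(lebesgue_on \<Omega>))"

definition L2_norm :: "(real ^ 'd) set \<Rightarrow> (real ^ 'd \<Rightarrow> real) \<Rightarrow> real" where
  "L2_norm \<Omega> f = sqrt (L2_inner \<Omega> f f)"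

definition partial_deriv :: "'d \<Rightarrow> (real ^ 'd \<Rightarrow> real) \<Rightarrow> real ^ 'd \<Rightarrow> real" where
  "partial_deriv i f x = frechet_derivative f (at x) (axis i 1)"

primrec Ck_fun :: "nat \<Rightarrow> (real ^ 'd \<Rightarrow> real) \<Rightarrow> bool" where
  "Ck_fun 0 f \<longleftrightarrow> continuous_on UNIV f"
| "Ck_fun (Suc m) f \<longleftrightarrow> f differentiable_on UNIV \<and> (\<forall>i. Ck_fun m (partial_deriv i f))"

definition test_functions :: "(real ^ 'd) set \<Rightarrow> (real ^ 'd \<Rightarrow> real) set" where
  "test_functions \<Omega> = {\<phi>. (\<forall>m. Ck_fun m \<phi>) \<and>
      compact (closure {x. \<phi> x \<noteq> 0}) \<and> closure {x. \<phi> x \<noteq> 0} \<subseteq> \<Omega>}"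

definition is_weak_grad ::
    "(real ^ 'd) set \<Rightarrow> (real ^ 'd \<Rightarrow> real) \<Rightarrow> (real ^ 'd \<Rightarrow> real ^ 'd) \<Rightarrow> bool" where
  "is_weak_grad \<Omega> v g \<longleftrightarrow>
     (\<forall>i. (\<lambda>x. g x $ i) \<in> L2_space \<Omega>) \<and>
     (\<forall>\<phi>\<in>test_functions \<Omega>. \<forall>i.
        L2_inner \<Omega> v (partial_deriv i \<phi>) = - L2_inner \<Omega> (\<lambda>x. g x $ i) \<phi>)"

definition H1_space :: "(real ^ 'd) set \<Rightarrow> (real ^ 'd \<Rightarrow> real) set" where
  "H1_space \<Omega> = {v \<in> L2_space \<Omega>. \<exists>g. is_weak_grad \<Omega> v g}"

text \<open>A weak gradient is unique only up to null sets; a representative is chosen.\<close>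

definition weak_grad :: "(real ^ 'd) set \<Rightarrow> (real ^ 'd \<Rightarrow> real) \<Rightarrow> real ^ 'd \<Rightarrow> real ^ 'd" where
  "weak_grad \<Omega> v = (SOME g. is_weak_grad \<Omega> v g)"

definition A_form :: "(real ^ 'd) set \<Rightarrow> (real ^ 'd \<Rightarrow> real) \<Rightarrow>
    (real ^ 'd \<Rightarrow> real) \<Rightarrow> (real ^ 'd \<Rightarrow> real) \<Rightarrow> real" where
  "A_form \<Omega> a q v = (\<integral>x. a x * (weak_grad \<Omega> q x \<bullet> weak_grad \<Omega> v x) \<partial>(lebesgue_on \<Omega>))"

section \<open>Mesh and finite element space\<close>

text \<open>Mesh cells are closed simplices of full dimension, so that \<open>\<Omega> = \<Union>T\<^sub>i\<close> is read as
  an identity for the closure of the open set \<open>\<Omega>\<close>. The library predicate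
  \<^const>\<open>triangulation\<close> says that the cells are finitely many and meet in common faces.\<close>

definition mesh_of :: "(real ^ 'd) set \<Rightarrow> (real ^ 'd) set set \<Rightarrow> bool" where
  "mesh_of \<Omega> \<T> \<longleftrightarrow> triangulation \<T> \<and> (\<forall>T\<in>\<T>. int CARD('d) simplex T) \<and> \<Union>\<T> = closure \<Omega>"

definition inradius :: "(real ^ 'd) set \<Rightarrow> real" where
  "inradius T = Sup {r. 0 \<le> r \<and> (\<exists>x. cball x r \<subseteq> T)}"

text \<open>Quasi-uniformity with constant \<open>\<rho>\<close>: the smallest diameter of an inscribed ball is at
  least \<open>\<rho>\<close> times the largest diameter of a cell.\<close>

definition quasi_uniform :: "real \<Rightarrow> (real ^ 'd) set set \<Rightarrow> bool" where
  "quasi_uniform \<rho> \<T> \<longleftrightarrow> 0 < \<rho> \<and> (\<forall>T\<in>\<T>. \<forall>T'\<in>\<T>. \<rho> * diameter T \<le> 2 * inradius T')"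

definition poly_space :: "nat \<Rightarrow> (real ^ 'd \<Rightarrow> real) set" where
  "poly_space k = {p. \<exists>c :: ('d \<Rightarrow> nat) \<Rightarrow> real.
      p = (\<lambda>x. \<Sum>\<alpha> | (\<Sum>i\<in>UNIV. \<alpha> i) \<le> k. c \<alpha> * (\<Prod>i\<in>UNIV. (x $ i) ^ \<alpha> i))}"

text \<open>Elements of \<open>V\<^sub>h\<close> are functions on the closure of \<open>\<Omega>\<close>. They are represented by total
  functions that vanish elsewhere, so that equality in HOL is equality on the closure.\<close>

definition V_h :: "(real ^ 'd) set \<Rightarrow> (real ^ 'd) set set \<Rightarrow> nat \<Rightarrow> (real ^ 'd \<Rightarrow> real) set" where
  "V_h \<Omega> \<T> k = {v. continuous_on (closure \<Omega>) v \<and> v \<in> H1_space \<Omega> \<and>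
      (\<forall>T\<in>\<T>. \<exists>p\<in>poly_space k. \<forall>x\<in>T. v x = p x) \<and>
      (\<forall>x. x \<notin> closure \<Omega> \<longrightarrow> v x = 0)}"

section \<open>The scheme and its energy\<close>

definition H_fun :: "(real \<Rightarrow> real) \<Rightarrow> (real \<Rightarrow> real) \<Rightarrow> real \<Rightarrow> real \<Rightarrow> real" where
  "H_fun F F' B w = F' w / sqrt (F w + B)"

definition energy :: "(real ^ 'd) set \<Rightarrow> real \<Rightarrow> real \<Rightarrow>
    (real ^ 'd \<Rightarrow> real) \<Rightarrow> (real ^ 'd \<Rightarrow> real) \<Rightarrow> real" where
  "energy \<Omega> \<epsilon> B v V = 1/2 * A_form \<Omega> (\<lambda>_. \<epsilon>\<^sup>2) v v
      + (\<integral>x. (V x)\<^sup>2 \<partial>(lebesgue_on \<Omega>)) - B * measure lebesgue \<Omega>"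

text \<open>\<open>h\<close> stands for \<open>H(u\<^sub>h\<^sup>n)\<close>; \<open>(u\<^sub>0, U\<^sub>0)\<close> and \<open>(u\<^sub>1, U\<^sub>1)\<close> are the old and the new iterate.\<close>

definition scheme_solution :: "(real ^ 'd) set \<Rightarrow> (real ^ 'd \<Rightarrow> real) set \<Rightarrow> real \<Rightarrow> real \<Rightarrow>
    (real ^ 'd \<Rightarrow> real) \<Rightarrow> (real ^ 'd \<Rightarrow> real) \<Rightarrow> (real ^ 'd \<Rightarrow> real) \<Rightarrow>
    (real ^ 'd \<Rightarrow> real) \<Rightarrow> (real ^ 'd \<Rightarrow> real) \<Rightarrow> bool" where
  "scheme_solution \<Omega> V \<epsilon> \<Delta>t h u0 U0 u1 U1 \<longleftrightarrow> u1 \<in> V \<and> U1 \<in> V \<and>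
     (\<forall>\<phi>\<in>V. L2_inner \<Omega> (\<lambda>x. (u1 x - u0 x) / \<Delta>t) \<phi> =
        - A_form \<Omega> (\<lambda>_. \<epsilon>\<^sup>2) u1 \<phi> - L2_inner \<Omega> (\<lambda>x. h x * U1 x) \<phi>) \<and>
     (\<forall>\<psi>\<in>V. L2_inner \<Omega> (\<lambda>x. (U1 x - U0 x) / \<Delta>t) \<psi> =
        L2_inner \<Omega> (\<lambda>x. 1/2 * h x * ((u1 x - u0 x) / \<Delta>t)) \<psi>)"

end

theory Submission
  imports Defs "HOL-Library.Function_Algebras"
begin

text \<open>
  Both equations of the scheme are linear in the unknown pair \<open>(u, U)\<close> because the nonlinear
  coefficient \<open>h = H(u0)\<close> is taken at the old iterate. Doubling the second equation and adding it
  to the first turns the scheme into one variational problem on the product space, with the form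
  \<open>m(u,\<phi>)/\<tau> + s(u,\<phi>) + (h U,\<phi>) + 2 m(U,\<psi>) - (h u,\<psi>)\<close>, where \<open>m\<close> is the \<open>L2\<close> product, \<open>s\<close> the
  Dirichlet form and \<open>\<tau>\<close> the time step. On the diagonal \<open>\<phi> = u\<close>, \<open>\<psi> = U\<close> the two coupling terms cancel
  and what is left is at least \<open>m(u,u)/\<tau> + 2 m(U,U)\<close>. The form is therefore anisotropic, and an
  anisotropic bilinear form on a finite-dimensional space represents every linear functional
  exactly once (\<open>galerkin_unique_solution\<close>). The energy law comes from testing with \<open>\<phi> = u - u0\<close>
  and \<open>\<psi> = U\<close>: the coupling terms cancel again, and the polarization identity
  \<open>2 a(u, u - v) = a(u,u) - a(v,v) + a(u - v, u - v)\<close> for \<open>a = s\<close> and \<open>a = m\<close> produces the energies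
  together with the dissipation. This linear algebra is carried out in the locale
  \<open>relaxed_step\<close>.

  What remains is to see that the concrete spaces and forms satisfy its hypotheses.

  \<^item> The space \<open>V_h\<close> is finite-dimensional: a piecewise polynomial is determined by its
    coefficients on the finitely many cells (\<open>V_h_finite_span\<close>).

  \<^item> The \<open>L2\<close> product is definite on \<open>V_h\<close>: a continuous function that vanishes almost everywhere on
    an open set vanishes on its closure (\<open>V_h_L2_inner_zero_imp_zero\<close>).

  \<^item> The Dirichlet form is bilinear. This is the analytic part. A weak gradient is an arbitrarily
    chosen representative, so the gradient of a sum is the sum of the gradients only if weak
    gradients are unique almost everywhere. Uniqueness is the fundamental lemma of the
    calculus of variations, \<open>orthogonal_to_test_functions_imp_AE_zero\<close>: an integrable function
    orthogonal to all test functions is zero almost everywhere. It is proved by approximating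
    the indicators of boxes with products of the functions \<open>exp(-1/t)\<close>, which gives vanishing
    integrals over boxes and then, by a Dynkin system argument, over all Borel sets.

  \<^item> The coefficient \<open>h\<close> is continuous on the compact closure of the domain, so multiplying by it
    keeps the elements of \<open>V_h\<close> square integrable.
\<close>

section \<open>Anisotropic forms on finite-dimensional spaces\<close>

text \<open>A Lax-Milgram lemma with coercivity weakened to \<open>a v v \<noteq> 0\<close> for \<open>v \<noteq> 0\<close>, which suffices in finite
dimension. Existence goes by Gram-Schmidt on the spanning set: a new generator \<open>b\<close> is corrected
by the element \<open>w\<close> of the old span that represents \<open>a b\<close> there, and the remainder \<open>z = b - w\<close> is
annihilated by the old span. The old solution then needs only a multiple of \<open>z\<close> added to it.\<close>

lemma (in vector_space) galerkin_unique_solution: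
  assumes "finite B"
    and nonzero: "\<And>v. v \<in> span B \<Longrightarrow> a v v = 0 \<Longrightarrow> v = 0"
    and left: "\<And>c u v w. u \<in> span B \<Longrightarrow> v \<in> span B \<Longrightarrow> w \<in> span B \<Longrightarrow>
       a (scale c u + v) w = c * a u w + a v w"
    and right: "\<And>c u v w. u \<in> span B \<Longrightarrow> v \<in> span B \<Longrightarrow> w \<in> span B \<Longrightarrow>
       a w (scale c u + v) = c * a w u + a w v"
    and lin: "\<And>c u v. u \<in> span B \<Longrightarrow> v \<in> span B \<Longrightarrow> l (scale c u + v) = c * l u + l v"
  shows "\<exists>!u. u \<in> span B \<and> (\<forall>v\<in>span B. a u v = l v)"
proof -
  have ex: "\<exists>u\<in>span B. \<forall>v\<in>span B. a u v = l v"
    using assms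
  proof (induction B arbitrary: l rule: finite_induct)
    case empty
    have "a 0 0 = 1 * a 0 0 + a 0 0" "l 0 = 1 * l 0 + l 0"
      using empty(2)[of 0 0 0 1] empty(4)[of 0 0 1] by simp_all
    then have "a 0 0 = 0" "l 0 = 0" by (simp_all only: mult_1_left add_cancel_right_left)
    then show ?case by auto
  next
    case (insert b B)
    let ?S = "span (insert b B)"
    have sub: "span B \<subseteq> ?S" by (rule span_mono) auto
    have IH: "\<exists>u\<in>span B. \<forall>v\<in>span B. a u v = m v"
      if "\<And>c u v. u \<in> span B \<Longrightarrow> v \<in> span B \<Longrightarrow> m (scale c u + v) = c * m u + m v" for m
      by (rule insert.IH) (use insert.prems sub that in \<open>auto simp: subset_iff\<close>)
    obtain u' where u': "u' \<in> span B" "\<And>v. v \<in> span B \<Longrightarrow> a u' v = l v"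
      using IH[of l] insert.prems(4) sub by blast
    have b: "b \<in> ?S" by (simp add: span_base)
    obtain w where w: "w \<in> span B" "\<And>v. v \<in> span B \<Longrightarrow> a w v = a b v"
      using IH[of "a b"] insert.prems(3) sub b by blast
    define z where "z = b - w"
    have z: "z \<in> ?S" using w(1) b sub unfolding z_def by (blast intro: span_diff)
    have zS: "z = scale (-1) w + b" by (simp add: z_def)
    have orth: "a z v = 0" if "v \<in> span B" for v
      unfolding zS using insert.prems(2)[of w b v "-1"] w that sub b by auto
    have dec: "\<exists>k v'. v' \<in> span B \<and> v = scale k z + v'" if v: "v \<in> ?S" for v
    proof -
      obtain k where k: "v - scale k b \<in> span B" using v span_breakdown_eq by blast
      have "v = scale k z + ((v - scale k b) + scale k w)"
        by (simp add: z_def scale_right_diff_distrib)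
      moreover have "(v - scale k b) + scale k w \<in> span B"
        using k w(1) by (intro span_add span_scale)
      ultimately show ?thesis by blast
    qed
    show ?case
    proof (cases "z = 0")
      case True
      then have "b \<in> span B" using w(1) by (simp add: z_def)
      then have "?S = span B" by (rule span_redundant)
      then show ?thesis using u' by auto
    next
      case False
      then have azz: "a z z \<noteq> 0" using insert.prems(1) z by blast
      define t where "t = (l z - a u' z) / a z z"
      define u where "u = scale t z + u'"
      have uS: "u \<in> ?S" using z u'(1) sub unfolding u_def by (blast intro: span_add span_scale)
      have "a u v = l v" if v: "v \<in> ?S" for v
      proof -
        obtain k v' where v': "v' \<in> span B" "v = scale k z + v'" using dec[OF v] by blast
        have v'S: "v' \<in> ?S" and u'S: "u' \<in> ?S" using v'(1) u'(1) sub by auto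
        have "a u v = t * (k * a z z + a z v') + (k * a u' z + a u' v')"
          unfolding u_def using insert.prems(2)[OF z u'S v] insert.prems(3) z u'S v'S v'(2) by simp
        also have "\<dots> = k * (t * a z z + a u' z) + l v'"
          using orth[OF v'(1)] u'(2)[OF v'(1)] by (simp add: algebra_simps)
        also have "t * a z z + a u' z = l z" using azz by (simp add: t_def)
        also have "k * l z + l v' = l v" using insert.prems(4) z v'S v'(2) by simp
        finally show ?thesis .
      qed
      then show ?thesis using uS by blast
    qed
  qed
  show ?thesis
  proof (rule ex_ex1I)
    show "\<exists>u. u \<in> span B \<and> (\<forall>v\<in>span B. a u v = l v)" using ex by blast
  next
    fix u u' assume u: "u \<in> span B \<and> (\<forall>v\<in>span B. a u v = l v)"
      and u': "u' \<in> span B \<and> (\<forall>v\<in>span B. a u' v = l v)"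
    define d where "d = scale (-1) u' + u"
    have d: "d \<in> span B" using u u' unfolding d_def by (blast intro: span_add span_scale)
    have "a d d = - a u' d + a u d" using left[of u' u d "-1"] u u' d by (simp add: d_def)
    then have "a d d = 0" using u u' d by simp
    then have "d = 0" using nonzero d by blast
    then show "u = u'" by (simp add: d_def)
  qed
qed

section \<open>Smooth bump functions\<close>

text \<open>The functions \<open>p(1/t) exp(-1/t)\<close>, extended by zero to \<open>t \<le> 0\<close>. Letting the polynomial \<open>p\<close> vary makes
this family closed under differentiation, so that smoothness of the case \<open>p = 1\<close> is a single
induction.\<close>

definition flat_exp :: "real poly \<Rightarrow> real \<Rightarrow> real" where
  "flat_exp p t = (if t > 0 then poly p (inverse t) * exp (- inverse t) else 0)"

lemma flat_exp_tendsto_0: "(flat_exp p \<longlongrightarrow> 0) (at 0)"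
proof -
  have "((\<lambda>y. \<Sum>i\<le>degree p. coeff p i * (y ^ i / exp y)) \<longlongrightarrow> (\<Sum>i\<le>degree p. coeff p i * 0)) at_top"
    by (intro tendsto_intros tendsto_power_div_exp_0)
  then have "((\<lambda>y. poly p y * exp (- y)) \<longlongrightarrow> 0) at_top"
    by (simp add: poly_altdef sum_distrib_right exp_minus divide_inverse mult.assoc)
  then have "((\<lambda>t. poly p (inverse t) * exp (- inverse t)) \<longlongrightarrow> 0) (at_right 0)"
    by (rule filterlim_compose) (rule filterlim_inverse_at_top_right)
  then have "(flat_exp p \<longlongrightarrow> 0) (at_right 0)"
    by (rule Lim_transform_eventually)
       (auto simp: flat_exp_def eventually_at_right[of 0 1] intro!: exI[of _ 1])
  moreover have "(flat_exp p \<longlongrightarrow> 0) (at_left 0)"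
    by (rule tendsto_eventually)
       (auto simp: flat_exp_def eventually_at_left[of "-1" 0] intro!: exI[of _ "-1"])
  ultimately show ?thesis by (simp add: filterlim_split_at)
qed

text \<open>Away from zero this is the quotient rule: with \<open>y = 1/t\<close>, \<open>d/dt (p(y) exp(-y)) = y\<^sup>2 (p(y) - p'(y)) exp(-y)\<close>.
At zero the difference quotient is itself a member of the family, for the polynomial
\<open>X p\<close>, and so tends to zero.\<close>

lemma flat_exp_has_derivative:
  "(flat_exp p has_real_derivative flat_exp (pCons 0 (pCons 0 (p - pderiv p))) t) (at t)"
proof -
  consider "t > 0" | "t < 0" | "t = 0" by linarith
  then show ?thesis
  proof cases
    case 1
    have "((\<lambda>t. poly p (inverse t) * exp (- inverse t)) has_real_derivative
        flat_exp (pCons 0 (pCons 0 (p - pderiv p))) t) (at t)"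
      using 1 by (auto intro!: derivative_eq_intros poly_DERIV[THEN DERIV_chain2]
          simp: flat_exp_def field_simps power2_eq_square)
    then show ?thesis
      by (rule has_field_derivative_transform_within_open[where S = "{0<..}"])
         (use 1 in \<open>auto simp: flat_exp_def\<close>)
  next
    case 2
    have "((\<lambda>t. 0) has_real_derivative flat_exp (pCons 0 (pCons 0 (p - pderiv p))) t) (at t)"
      using 2 by (simp add: flat_exp_def)
    then show ?thesis
      by (rule has_field_derivative_transform_within_open[where S = "{..<0}"])
         (use 2 in \<open>auto simp: flat_exp_def\<close>)
  next
    case 3
    have eq: "(\<lambda>h. (flat_exp p (0 + h) - flat_exp p 0) / h) = flat_exp (pCons 0 p)"
      by (simp add: fun_eq_iff flat_exp_def field_simps)
    show ?thesis
      using 3 flat_exp_tendsto_0[of "pCons 0 p"]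
      by (simp only: DERIV_def eq) (simp add: flat_exp_def[of _ 0])
  qed
qed

lemma partial_deriv_eq:
  "(f has_derivative f') (at x) \<Longrightarrow> partial_deriv i f x = f' (axis i 1)"
  by (metis frechet_derivative_at partial_deriv_def)

lemma differentiable_on_UNIV_iff: "f differentiable_on UNIV \<longleftrightarrow> (\<forall>x. f differentiable (at x))"
  by (simp add: differentiable_on_def)

lemma Ck_fun_SucI:
  assumes "\<And>x. (f has_derivative f' x) (at x)" "\<And>i. Ck_fun m (\<lambda>x. f' x (axis i 1))"
  shows "Ck_fun (Suc m) f"
proof -
  have "partial_deriv i f = (\<lambda>x. f' x (axis i 1))" for i
    using partial_deriv_eq assms(1) by blast
  then show ?thesis
    using assms by (auto simp: differentiable_on_UNIV_iff differentiable_def)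
qed

lemma Ck_fun_SucD: "Ck_fun (Suc m) f \<Longrightarrow> Ck_fun m f"
proof (induction m arbitrary: f)
  case 0
  then show ?case by (auto intro: differentiable_imp_continuous_on)
next
  case (Suc m)
  then show ?case by (metis Ck_fun.simps(2))
qed

lemma Ck_fun_has_derivative:
  assumes "Ck_fun (Suc m) f"
  shows "(f has_derivative frechet_derivative f (at x)) (at x)"
  using assms by (simp add: differentiable_on_UNIV_iff frechet_derivative_works)

lemma Ck_fun_partial_deriv:
  assumes "Ck_fun (Suc m) f"
  shows "Ck_fun m (\<lambda>x. frechet_derivative f (at x) (axis i 1))"
proof -
  have "partial_deriv i f = (\<lambda>x. frechet_derivative f (at x) (axis i 1))"
    by (simp add: fun_eq_iff partial_deriv_def)
  then show ?thesis using assms by (metis Ck_fun.simps(2))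
qed

lemma Ck_fun_const: "Ck_fun m (\<lambda>_. c)"
proof (induction m arbitrary: c)
  case (Suc m)
  show ?case by (rule Ck_fun_SucI[OF has_derivative_const]) (rule Suc)
qed simp

lemma Ck_fun_add: "Ck_fun m f \<Longrightarrow> Ck_fun m g \<Longrightarrow> Ck_fun m (\<lambda>x. f x + g x)"
proof (induction m arbitrary: f g)
  case 0
  then show ?case by (auto intro: continuous_intros)
next
  case (Suc m)
  show ?case
    by (rule Ck_fun_SucI[OF has_derivative_add])
       (rule Ck_fun_has_derivative Suc Ck_fun_partial_deriv)+
qed

lemma Ck_fun_mult: "Ck_fun m f \<Longrightarrow> Ck_fun m g \<Longrightarrow> Ck_fun m (\<lambda>x. f x * g x)"
proof (induction m arbitrary: f g)
  case 0
  then show ?case by (auto intro: continuous_intros)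
next
  case (Suc m)
  show ?case
    by (rule Ck_fun_SucI[OF has_derivative_mult])
       (rule Ck_fun_has_derivative Suc Ck_fun_partial_deriv Ck_fun_add Ck_fun_SucD)+
qed

lemma Ck_fun_prod: "(\<And>i. i \<in> J \<Longrightarrow> Ck_fun m (f i)) \<Longrightarrow> Ck_fun m (\<lambda>x. \<Prod>i\<in>J. f i x)"
  by (induction J rule: infinite_finite_induct) (auto intro: Ck_fun_const Ck_fun_mult)

text \<open>Affine functions of one coordinate are the only arguments that are ever inserted, and stating the
result for all \<open>p\<close> makes the induction hypothesis cover the derivative.\<close>

lemma Ck_fun_flat_exp: "Ck_fun m (\<lambda>x. flat_exp p (\<alpha> * x $ i + \<beta>))"
proof (induction m arbitrary: p)
  case 0
  have "continuous_on UNIV (flat_exp p)"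
    by (meson continuous_at_imp_continuous_on DERIV_isCont flat_exp_has_derivative)
  then show ?case
    unfolding Ck_fun.simps
    by (rule continuous_on_compose2) (auto intro!: continuous_intros)
next
  case (Suc m)
  let ?q = "pCons 0 (pCons 0 (p - pderiv p))"
  have "((\<lambda>x. flat_exp p (\<alpha> * x $ i + \<beta>)) has_derivative
     (\<lambda>h. flat_exp ?q (\<alpha> * x $ i + \<beta>) * (\<alpha> * h $ i))) (at x)" for x :: "real ^ 'a"
  proof -
    have "((\<lambda>x. \<alpha> * x $ i + \<beta>) has_derivative (\<lambda>h. \<alpha> * h $ i)) (at x)"
      by (auto intro!: derivative_eq_intros bounded_linear_imp_has_derivative bounded_linear_vec_nth)
    then show ?thesis
      by (rule has_derivative_compose)
         (rule flat_exp_has_derivative[unfolded has_field_derivative_def])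
  qed
  then show ?case
    by (rule Ck_fun_SucI) (intro Ck_fun_mult Suc Ck_fun_const)
qed

text \<open>On the open box this is \<open>exp(-q(x)/(n+1))\<close> with a positive function \<open>q\<close>, and off the box it is zero.
It increases to the indicator of the box as \<open>n\<close> tends to infinity; the shift to \<open>n + 1\<close> keeps the
scaling factor positive.\<close>

definition box_bump :: "real ^ 'd \<Rightarrow> real ^ 'd \<Rightarrow> nat \<Rightarrow> real ^ 'd \<Rightarrow> real" where
  "box_bump a b n x = (\<Prod>i\<in>UNIV. flat_exp 1 (real (Suc n) * (x $ i - a $ i)) *
     flat_exp 1 (real (Suc n) * (b $ i - x $ i)))"

lemma box_bump_outside: "x \<notin> box a b \<Longrightarrow> box_bump a b n x = 0"
  by (auto simp: box_bump_def mem_box_cart flat_exp_def zero_less_mult_iff)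

lemma box_bump_bounds: "0 \<le> box_bump a b n x" "box_bump a b n x \<le> 1"
proof -
  have flat: "0 \<le> flat_exp 1 t" "flat_exp 1 t \<le> 1" for t by (simp_all add: flat_exp_def)
  show "0 \<le> box_bump a b n x"
    unfolding box_bump_def by (intro prod_nonneg mult_nonneg_nonneg flat)
  show "box_bump a b n x \<le> 1"
    unfolding box_bump_def by (intro prod_le_1 conjI mult_nonneg_nonneg mult_le_one flat)
qed

lemma flat_exp_1_tendsto_1:
  assumes "t > 0"
  shows "(\<lambda>n. flat_exp 1 (real (Suc n) * t)) \<longlonglongrightarrow> 1"
proof -
  have "(\<lambda>n. exp (- (inverse (real (Suc n)) * inverse t))) \<longlonglongrightarrow> exp (- (0 * inverse t))"
    by (intro tendsto_intros LIMSEQ_inverse_real_of_nat)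
  then show ?thesis using assms by (simp add: flat_exp_def mult.commute)
qed

lemma box_bump_tendsto_indicator: "(\<lambda>n. box_bump a b n x) \<longlonglongrightarrow> indicator (box a b) x"
proof (cases "x \<in> box a b")
  case True
  have "(\<lambda>n. box_bump a b n x) \<longlonglongrightarrow> (\<Prod>i\<in>(UNIV :: 'a set). 1 * 1)"
    unfolding box_bump_def
    using True by (intro tendsto_prod tendsto_mult flat_exp_1_tendsto_1) (auto simp: mem_box_cart)
  then show ?thesis using True by simp
qed (simp add: box_bump_outside)

lemma Ck_fun_box_bump: "Ck_fun m (box_bump a b n)"
proof -
  have "Ck_fun m (\<lambda>x. flat_exp 1 (real (Suc n) * x $ i + (- real (Suc n) * a $ i)) *
     flat_exp 1 (- real (Suc n) * x $ i + real (Suc n) * b $ i))" for i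
    by (intro Ck_fun_mult Ck_fun_flat_exp)
  then show ?thesis
    unfolding box_bump_def[abs_def] by (intro Ck_fun_prod) (simp add: algebra_simps)
qed

lemma box_bump_test_function:
  assumes "closure (box a b) \<subseteq> \<Omega>"
  shows "box_bump a b n \<in> test_functions \<Omega>"
proof -
  have sub: "{x. box_bump a b n x \<noteq> 0} \<subseteq> box a b" using box_bump_outside by blast
  then have "bounded {x. box_bump a b n x \<noteq> 0}" using bounded_box bounded_subset by blast
  then show ?thesis
    using closure_mono[OF sub] assms by (auto simp: test_functions_def Ck_fun_box_bump)
qed

section \<open>The fundamental lemma of the calculus of variations\<close>

text \<open>The boxes form a generator of the Borel sets stable under intersection, so that the sets with zero
integral, which form a Dynkin system, include all Borel sets. Vanishing of the total integral
serves for complements. The function is first replaced by a Borel measurable one, because the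
generator does not reach all Lebesgue measurable sets.\<close>

lemma integrable_AE_zero_if_zero_on_boxes:
  fixes g :: "'a::euclidean_space \<Rightarrow> real"
  assumes g: "integrable lebesgue g"
    and total: "(\<integral>x. g x \<partial>lebesgue) = 0"
    and boxes: "\<And>a b. (\<integral>x. indicator (box a b) x * g x \<partial>lebesgue) = 0"
  shows "AE x in lebesgue. g x = 0"
proof -
  have "g \<in> borel_measurable lebesgue" using g by simp
  then obtain g' where g'[measurable]: "g' \<in> borel_measurable lborel" and eq: "AE x in lborel. g x = g' x"
    using completion_ex_borel_measurable_real by blast
  have eq': "AE x in lebesgue. g x = g' x" using eq by (rule AE_completion)
  have g'leb: "g' \<in> borel_measurable lebesgue" using g' by (rule measurable_completion)
  have transfer: "(\<integral>x. indicator A x * g' x \<partial>lborel) = (\<integral>x. indicator A x * g x \<partial>lebesgue)"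
    if A[measurable]: "A \<in> sets borel" for A
  proof -
    have A': "A \<in> sets lebesgue" using A by simp
    have "(\<integral>x. indicator A x * g' x \<partial>lborel) = (\<integral>x. indicator A x * g' x \<partial>lebesgue)"
      by (rule integral_completion[symmetric]) measurable
    also have "\<dots> = (\<integral>x. indicator A x * g x \<partial>lebesgue)"
      by (intro integral_cong_AE borel_measurable_times borel_measurable_indicator A' g'leb
            borel_measurable_integrable[OF g]) (use eq' in \<open>auto elim: eventually_mono\<close>)
    finally show ?thesis .
  qed
  have "integrable lebesgue g'"
    using integrable_cong_AE[OF borel_measurable_integrable[OF g] g'leb eq'] g by simp
  then have g'int: "integrable lborel g'" using integrable_completion[OF g'] by simp
  have g'A: "integrable lborel (\<lambda>x. indicator A x * g' x)" if "A \<in> sets borel" for A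
    using integrable_mult_indicator[of A lborel g'] that g'int by simp
  have g'total: "(\<integral>x. g' x \<partial>lborel) = 0"
    using transfer[of UNIV] total by simp
  have zero: "(\<integral>x. indicator A x * g' x \<partial>lborel) = 0" if A: "A \<in> sets borel" for A
  proof -
    let ?E = "range (\<lambda>(a, b). box a b :: 'a set)"
    have "Int_stable ?E" by (auto simp: Int_stable_def box_Int_box)
    moreover have "?E \<subseteq> Pow UNIV" by simp
    moreover have "A \<in> sigma_sets UNIV ?E" using A by (simp add: borel_eq_box)
    ultimately show ?thesis
    proof (induction rule: sigma_sets_induct_disjoint)
      case (basic A)
      then show ?case using transfer boxes by auto
    next
      case empty
      then show ?case by simp
    next
      case (compl A)
      then have A: "A \<in> sets borel" by (simp add: borel_eq_box)
      have "(\<integral>x. indicator (UNIV - A) x * g' x \<partial>lborel)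
          = (\<integral>x. g' x - indicator A x * g' x \<partial>lborel)"
        by (intro Bochner_Integration.integral_cong) (auto simp: indicator_def)
      also have "\<dots> = 0" using compl g'int g'A[OF A] g'total by simp
      finally show ?case .
    next
      case (union A)
      then have A: "A i \<in> sets borel" for i by (auto simp: borel_eq_box)
      have "(LINT x:(\<Union>i. A i)|lborel. g' x) = (\<Sum>i. LINT x:A i|lborel. g' x)"
      proof (rule lebesgue_integral_countable_add)
        show "set_integrable lborel (\<Union>i. A i) g'"
          using g'A[of "\<Union>i. A i"] A by (simp add: set_integrable_def)
      qed (use A union in \<open>auto simp: disjoint_family_on_def\<close>)
      then show ?case using union by (simp add: set_lebesgue_integral_def)
    qed
  qed
  have "AE x in lborel. g' x = 0"
    by (rule density_unique_real) (use g'int zero in \<open>auto simp: set_lebesgue_integral_def\<close>)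
  then have "AE x in lebesgue. g' x = 0" by (rule AE_completion)
  with eq' show ?thesis by eventually_elim simp
qed

lemma continuous_imp_lebesgue_measurable_on_open:
  fixes f :: "real ^ 'd \<Rightarrow> real"
  assumes "continuous_on \<Omega> f" "open \<Omega>"
  shows "f \<in> borel_measurable (lebesgue_on \<Omega>)"
  using assms by (intro continuous_imp_measurable_on_sets_lebesgue) auto

text \<open>Dominated convergence along the bump functions, with \<open>\<bar>f\<bar>\<close> as the majorant.\<close>

lemma orthogonal_to_test_functions_imp_zero_on_box:
  fixes f :: "real ^ 'd \<Rightarrow> real"
  assumes "open \<Omega>" and f: "integrable (lebesgue_on \<Omega>) f"
    and orth: "\<And>\<phi>. \<phi> \<in> test_functions \<Omega> \<Longrightarrow> L2_inner \<Omega> f \<phi> = 0"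
    and sub: "closure (box a b) \<subseteq> \<Omega>"
  shows "(\<integral>x. f x * indicator (box a b) x \<partial>lebesgue_on \<Omega>) = 0"
proof -
  have bump: "box_bump a b n \<in> borel_measurable (lebesgue_on \<Omega>)" for n
    using Ck_fun_box_bump[of 0 a b n] \<open>open \<Omega>\<close>
    by (intro continuous_imp_lebesgue_measurable_on_open) (auto intro: continuous_on_subset)
  have box: "indicat_real (box a b) \<in> borel_measurable (lebesgue_on \<Omega>)"
    by (intro measurable_restrict_space1 borel_measurable_indicator) simp
  have "(\<lambda>n. \<integral>x. f x * box_bump a b n x \<partial>lebesgue_on \<Omega>)
        \<longlonglongrightarrow> (\<integral>x. f x * indicator (box a b) x \<partial>lebesgue_on \<Omega>)"
  proof (rule integral_dominated_convergence[where w = "\<lambda>x. \<bar>f x\<bar>"])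
    show "AE x in lebesgue_on \<Omega>. norm (f x * box_bump a b n x) \<le> \<bar>f x\<bar>" for n
      using box_bump_bounds[of a b n] by (auto simp: abs_mult mult_left_le)
    show "AE x in lebesgue_on \<Omega>. (\<lambda>n. f x * box_bump a b n x) \<longlonglongrightarrow> f x * indicator (box a b) x"
      by (intro AE_I2 tendsto_intros box_bump_tendsto_indicator)
  qed (use f bump box in auto)
  moreover have "(\<integral>x. f x * box_bump a b n x \<partial>lebesgue_on \<Omega>) = 0" for n
    using orth[OF box_bump_test_function[OF sub]] by (simp add: L2_inner_def)
  ultimately show ?thesis by (simp add: LIMSEQ_const_iff)
qed

text \<open>The fundamental lemma of the calculus of variations. The closure of a box can leave \<open>\<Omega>\<close>, so
the argument is localized: \<open>f\<close> is cut off to a box whose closure is inside \<open>\<Omega>\<close>. The intersection of any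
box with that one is again a box with closure inside \<open>\<Omega>\<close>, and countably many closed boxes cover \<open>\<Omega>\<close>.\<close>

lemma orthogonal_to_test_functions_imp_AE_zero:
  fixes f :: "real ^ 'd \<Rightarrow> real"
  assumes "open \<Omega>" and f: "integrable (lebesgue_on \<Omega>) f"
    and orth: "\<And>\<phi>. \<phi> \<in> test_functions \<Omega> \<Longrightarrow> L2_inner \<Omega> f \<phi> = 0"
  shows "AE x in lebesgue_on \<Omega>. f x = 0"
proof -
  have \<Omega>: "\<Omega> \<in> sets lebesgue" using \<open>open \<Omega>\<close> by auto
  have on_cbox: "AE x in lebesgue. x \<in> cbox c d \<longrightarrow> f x = 0" if cd: "cbox c d \<subseteq> \<Omega>" for c d
  proof -
    define g where "g x = (if x \<in> \<Omega> then f x * indicator (box c d) x else 0)" for x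
    have box: "indicat_real (box c d) \<in> borel_measurable (lebesgue_on \<Omega>)"
      by (intro measurable_restrict_space1 borel_measurable_indicator) simp
    have "integrable (lebesgue_on \<Omega>) (\<lambda>x. f x * indicator (box c d) x)"
    proof (rule Bochner_Integration.integrable_bound[OF f])
      show "(\<lambda>x. f x * indicat_real (box c d) x) \<in> borel_measurable (lebesgue_on \<Omega>)"
        by (intro borel_measurable_times borel_measurable_integrable[OF f] box)
      show "AE x in lebesgue_on \<Omega>. norm (f x * indicat_real (box c d) x) \<le> norm (f x)"
        by (rule AE_I2) (simp add: indicator_def)
    qed
    then have g: "integrable lebesgue g"
      unfolding g_def by (rule Lebesgue_Measure.integrable_restrict_UNIV[OF \<Omega>, THEN iffD2])
    have zero: "(\<integral>x. indicator (box a b) x * g x \<partial>lebesgue) = 0" for a b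
    proof -
      obtain a' b' where ab: "box a b \<inter> box c d = box a' b'"
        by (rule that[OF box_Int_box])
      have "box a' b' \<subseteq> cbox c d" using ab box_subset_cbox[of c d] by blast
      then have "closure (box a' b') \<subseteq> cbox c d" by (rule closure_minimal) (rule closed_cbox)
      then have "closure (box a' b') \<subseteq> \<Omega>" using cd by (rule order_trans)
      then have "0 = (\<integral>x. f x * indicator (box a' b') x \<partial>lebesgue_on \<Omega>)"
        by (intro orthogonal_to_test_functions_imp_zero_on_box[symmetric] \<open>open \<Omega>\<close> f orth)
      also have "\<dots> = (\<integral>x. (if x \<in> \<Omega> then f x * indicator (box a' b') x else 0) \<partial>lebesgue)"
        by (rule Lebesgue_Measure.integral_restrict_UNIV[OF \<Omega>, symmetric])
      also have "\<dots> = (\<integral>x. indicator (box a b) x * g x \<partial>lebesgue)"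
        by (intro Bochner_Integration.integral_cong) (auto simp: g_def indicator_def ab[symmetric])
      finally show ?thesis by simp
    qed
    have "(\<integral>x. g x \<partial>lebesgue) = (\<integral>x. indicator (box c d) x * g x \<partial>lebesgue)"
      by (intro Bochner_Integration.integral_cong) (auto simp: g_def indicator_def)
    then have "AE x in lebesgue. g x = 0"
      using zero integrable_AE_zero_if_zero_on_boxes[OF g] by simp
    \<comment> \<open>the covering uses closed boxes, the cut-off an open one\<close>
    moreover have "AE x in lebesgue. x \<notin> cbox c d - box c d"
      using negligible_frontier_interval[of c d] by (intro AE_not_in) (simp add: negligible_iff_null_sets)
    ultimately show ?thesis
    proof eventually_elim
      case (elim x)
      then show ?case using cd by (auto simp: g_def)
    qed
  qed
  obtain \<D> where \<D>: "countable \<D>" "\<D> \<subseteq> Pow \<Omega>" "\<And>X. X \<in> \<D> \<Longrightarrow> \<exists>a b. X = cbox a b" "\<Union>\<D> = \<Omega>"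
    by (rule open_countable_Union_open_cbox[OF \<open>open \<Omega>\<close>]) (rule that)
  have "AE x in lebesgue. x \<in> X \<longrightarrow> f x = 0" if X: "X \<in> \<D>" for X
  proof -
    obtain a b where "X = cbox a b" using \<D>(3)[OF X] by blast
    then show ?thesis using on_cbox \<D>(2) X by auto
  qed
  then have "AE x in lebesgue. \<forall>X\<in>\<D>. x \<in> X \<longrightarrow> f x = 0"
    by (subst AE_ball_countable[OF \<D>(1)]) blast
  then have "AE x in lebesgue. x \<in> \<Omega> \<longrightarrow> f x = 0"
    unfolding \<D>(4)[symmetric] by (rule eventually_mono) blast
  then show ?thesis
    using \<Omega> by (simp add: AE_restrict_space_iff)
qed

section \<open>Square integrable functions and weak gradients\<close>

lemma L2_space_mult_integrable:
  assumes "f \<in> L2_space \<Omega>" "g \<in> L2_space \<Omega>"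
  shows "integrable (lebesgue_on \<Omega>) (\<lambda>x. f x * g x)"
proof (rule Bochner_Integration.integrable_bound[where f = "\<lambda>x. (f x)\<^sup>2 + (g x)\<^sup>2"])
  have "\<bar>a * b\<bar> \<le> a\<^sup>2 + b\<^sup>2" for a b :: real
    using sum_squares_bound[of "\<bar>a\<bar>" "\<bar>b\<bar>"] mult_nonneg_nonneg[of "\<bar>a\<bar>" "\<bar>b\<bar>"]
    by (simp add: abs_mult del: mult_nonneg_nonneg zero_le_mult_iff)
  then show "AE x in lebesgue_on \<Omega>. norm (f x * g x) \<le> norm ((f x)\<^sup>2 + (g x)\<^sup>2)"
    by auto
qed (use assms in \<open>auto simp: L2_space_def\<close>)

lemma L2_space_lincomb:
  assumes f: "f \<in> L2_space \<Omega>" and g: "g \<in> L2_space \<Omega>"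
  shows "(\<lambda>x. c * f x + g x) \<in> L2_space \<Omega>"
proof -
  have "integrable (lebesgue_on \<Omega>) (\<lambda>x. c\<^sup>2 * (f x * f x) + 2 * c * (f x * g x) + g x * g x)"
    using L2_space_mult_integrable f g by (intro Bochner_Integration.integrable_add integrable_mult_right) auto
  then have "integrable (lebesgue_on \<Omega>) (\<lambda>x. (c * f x + g x)\<^sup>2)"
    by (rule Bochner_Integration.integrable_cong[THEN iffD1, rotated 2])
       (auto simp: power2_eq_square algebra_simps)
  then show ?thesis using f g by (auto simp: L2_space_def)
qed

lemma continuous_on_closure_imp_L2_space:
  fixes f :: "real ^ 'd \<Rightarrow> real"
  assumes "open \<Omega>" "bounded \<Omega>" "continuous_on (closure \<Omega>) f"
  shows "f \<in> L2_space \<Omega>"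
proof -
  have meas: "f \<in> borel_measurable (lebesgue_on \<Omega>)"
    using assms continuous_on_subset closure_subset
    by (intro continuous_imp_lebesgue_measurable_on_open) blast+
  have "compact (f ` closure \<Omega>)"
    using assms by (intro compact_continuous_image) auto
  then obtain K where K: "\<And>x. x \<in> closure \<Omega> \<Longrightarrow> \<bar>f x\<bar> \<le> K"
    using compact_imp_bounded bounded_iff by (metis imageI real_norm_def)
  interpret finite_measure "lebesgue_on \<Omega>"
    using assms by (intro finite_measure_lebesgue_on lmeasurable_open)
  have "integrable (lebesgue_on \<Omega>) (\<lambda>x. (f x)\<^sup>2)"
  proof (rule integrable_const_bound[where B = "K\<^sup>2"])
    show "AE x in lebesgue_on \<Omega>. norm ((f x)\<^sup>2) \<le> K\<^sup>2"
    proof (rule AE_I2)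
      fix x assume "x \<in> space (lebesgue_on \<Omega>)"
      then have "\<bar>f x\<bar> \<le> K" using K closure_subset by auto
      then have "\<bar>f x\<bar>\<^sup>2 \<le> K\<^sup>2" by (rule power_mono) simp
      then show "norm ((f x)\<^sup>2) \<le> K\<^sup>2" by simp
    qed
  qed (use meas in auto)
  then show ?thesis using meas by (simp add: L2_space_def)
qed

lemma L2_inner_lincomb:
  assumes "f \<in> L2_space \<Omega>" "g \<in> L2_space \<Omega>" "k \<in> L2_space \<Omega>"
  shows "L2_inner \<Omega> (\<lambda>x. c * f x + g x) k = c * L2_inner \<Omega> f k + L2_inner \<Omega> g k"
  using L2_space_mult_integrable[OF assms(1,3)] L2_space_mult_integrable[OF assms(2,3)]
  by (simp add: L2_inner_def distrib_right mult.assoc)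

lemma L2_inner_commute: "L2_inner \<Omega> f g = L2_inner \<Omega> g f"
  by (simp add: L2_inner_def mult.commute)

lemma L2_inner_nonneg: "0 \<le> L2_inner \<Omega> f f"
  by (simp add: L2_inner_def)

lemma test_function_L2:
  assumes "open \<Omega>" "bounded \<Omega>" "\<phi> \<in> test_functions \<Omega>"
  shows "\<phi> \<in> L2_space \<Omega>" "partial_deriv i \<phi> \<in> L2_space \<Omega>"
proof -
  have "Ck_fun 0 \<phi>" "Ck_fun (Suc 0) \<phi>" using assms by (auto simp: test_functions_def simp del: Ck_fun.simps)
  then have "continuous_on UNIV \<phi>" "continuous_on UNIV (partial_deriv i \<phi>)" by auto
  then show "\<phi> \<in> L2_space \<Omega>" "partial_deriv i \<phi> \<in> L2_space \<Omega>"
    using assms by (auto intro!: continuous_on_closure_imp_L2_space intro: continuous_on_subset)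
qed

lemma is_weak_grad_lincomb:
  assumes "open \<Omega>" "bounded \<Omega>" "u \<in> L2_space \<Omega>" "v \<in> L2_space \<Omega>"
    and "is_weak_grad \<Omega> u g" "is_weak_grad \<Omega> v g'"
  shows "is_weak_grad \<Omega> (\<lambda>x. c * u x + v x) (\<lambda>x. c *\<^sub>R g x + g' x)"
  using assms test_function_L2[OF assms(1,2)]
  by (auto simp: is_weak_grad_def L2_space_lincomb L2_inner_lincomb)

text \<open>The components of the difference of two weak gradients are orthogonal to all test functions. They
are integrable because \<open>\<Omega>\<close> has finite measure.\<close>

lemma is_weak_grad_unique:
  assumes "open \<Omega>" "bounded \<Omega>" "is_weak_grad \<Omega> v g" "is_weak_grad \<Omega> v g'"
  shows "AE x in lebesgue_on \<Omega>. g x = g' x"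
proof -
  have "AE x in lebesgue_on \<Omega>. g x $ i = g' x $ i" for i
  proof -
    have g: "(\<lambda>x. g x $ i) \<in> L2_space \<Omega>" "(\<lambda>x. g' x $ i) \<in> L2_space \<Omega>"
      using assms by (auto simp: is_weak_grad_def)
    have d: "(\<lambda>x. - 1 * g' x $ i + g x $ i) \<in> L2_space \<Omega>" by (intro L2_space_lincomb g)
    have "(\<lambda>_. 1) \<in> L2_space \<Omega>"
      using assms by (auto intro: continuous_on_closure_imp_L2_space)
    from L2_space_mult_integrable[OF d this]
    have "integrable (lebesgue_on \<Omega>) (\<lambda>x. - 1 * g' x $ i + g x $ i)" by simp
    moreover have "L2_inner \<Omega> (\<lambda>x. - 1 * g' x $ i + g x $ i) \<phi> = 0" if \<phi>: "\<phi> \<in> test_functions \<Omega>" for \<phi>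
      using assms(3,4) \<phi> L2_inner_lincomb[OF g(2,1) test_function_L2(1)[OF assms(1,2) \<phi>], of "- 1"]
      by (simp add: is_weak_grad_def)
    ultimately have "AE x in lebesgue_on \<Omega>. - 1 * g' x $ i + g x $ i = 0"
      by (rule orthogonal_to_test_functions_imp_AE_zero[OF \<open>open \<Omega>\<close>])
    then show ?thesis by eventually_elim simp
  qed
  then have "AE x in lebesgue_on \<Omega>. \<forall>i\<in>UNIV. g x $ i = g' x $ i"
    by (intro AE_finite_allI) auto
  then show ?thesis by eventually_elim (simp add: vec_eq_iff)
qed

lemma weak_grad_is_weak_grad: "v \<in> H1_space \<Omega> \<Longrightarrow> is_weak_grad \<Omega> v (weak_grad \<Omega> v)"
  unfolding weak_grad_def H1_space_def by (auto intro: someI[of "is_weak_grad \<Omega> v"])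

lemma H1_space_lincomb:
  assumes "open \<Omega>" "bounded \<Omega>" "u \<in> H1_space \<Omega>" "v \<in> H1_space \<Omega>"
  shows "(\<lambda>x. c * u x + v x) \<in> H1_space \<Omega>"
  using assms is_weak_grad_lincomb[OF assms(1,2)] L2_space_lincomb
  unfolding H1_space_def by blast

text \<open>Both sides are weak gradients of the same function. Equality holds only almost everywhere, since
each chosen representative is independent of the others; inside an integral that is enough.\<close>

lemma weak_grad_lincomb:
  assumes "open \<Omega>" "bounded \<Omega>" "u \<in> H1_space \<Omega>" "v \<in> H1_space \<Omega>"
  shows "AE x in lebesgue_on \<Omega>. weak_grad \<Omega> (\<lambda>x. c * u x + v x) x = c *\<^sub>R weak_grad \<Omega> u x + weak_grad \<Omega> v x"
proof (rule is_weak_grad_unique[OF assms(1,2)])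
  show "is_weak_grad \<Omega> (\<lambda>x. c * u x + v x) (\<lambda>x. c *\<^sub>R weak_grad \<Omega> u x + weak_grad \<Omega> v x)"
    using assms by (intro is_weak_grad_lincomb weak_grad_is_weak_grad) (auto simp: H1_space_def)
qed (intro weak_grad_is_weak_grad H1_space_lincomb assms)

lemma weak_grad_inner_integrable:
  assumes "u \<in> H1_space \<Omega>" "v \<in> H1_space \<Omega>"
  shows "integrable (lebesgue_on \<Omega>) (\<lambda>x. weak_grad \<Omega> u x \<bullet> weak_grad \<Omega> v x)"
  unfolding inner_vec_def
  using weak_grad_is_weak_grad[OF assms(1)] weak_grad_is_weak_grad[OF assms(2)]
  by (auto simp: is_weak_grad_def intro!: L2_space_mult_integrable)

lemma A_form_lincomb:
  assumes "open \<Omega>" "bounded \<Omega>" and u: "u \<in> H1_space \<Omega>" and v: "v \<in> H1_space \<Omega>" and w: "w \<in> H1_space \<Omega>"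
  shows "A_form \<Omega> (\<lambda>_. a) (\<lambda>x. c * u x + v x) w = c * A_form \<Omega> (\<lambda>_. a) u w + A_form \<Omega> (\<lambda>_. a) v w"
proof -
  let ?G = "weak_grad \<Omega>"
  note int = weak_grad_inner_integrable
  have "A_form \<Omega> (\<lambda>_. a) (\<lambda>x. c * u x + v x) w
      = (\<integral>x. c * (a * (?G u x \<bullet> ?G w x)) + a * (?G v x \<bullet> ?G w x) \<partial>lebesgue_on \<Omega>)"
    unfolding A_form_def
  proof (rule integral_cong_AE)
    show "AE x in lebesgue_on \<Omega>. a * (?G (\<lambda>x. c * u x + v x) x \<bullet> ?G w x)
        = c * (a * (?G u x \<bullet> ?G w x)) + a * (?G v x \<bullet> ?G w x)"
      using weak_grad_lincomb[OF assms(1-4), of c]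
      by eventually_elim (simp add: inner_add_left algebra_simps)
  qed (use int[OF H1_space_lincomb[OF assms(1-4)] w] int[OF u w] int[OF v w] in auto)
  also have "\<dots> = c * A_form \<Omega> (\<lambda>_. a) u w + A_form \<Omega> (\<lambda>_. a) v w"
    using int[OF u w] int[OF v w] by (simp add: A_form_def)
  finally show ?thesis .
qed

lemma A_form_commute: "A_form \<Omega> a u v = A_form \<Omega> a v u"
  by (simp add: A_form_def inner_commute)

lemma A_form_nonneg: "(\<And>x. 0 \<le> a x) \<Longrightarrow> 0 \<le> A_form \<Omega> a v v"
  by (simp add: A_form_def)

section \<open>The finite element space\<close>

lemma poly_space_lincomb:
  assumes "p \<in> poly_space k" "q \<in> poly_space k"
  shows "(\<lambda>x. c * p x + q x) \<in> poly_space k"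
proof -
  obtain d e where "p = (\<lambda>x. \<Sum>\<alpha> | (\<Sum>i\<in>UNIV. \<alpha> i) \<le> k. d \<alpha> * (\<Prod>i\<in>UNIV. (x $ i) ^ \<alpha> i))"
     "q = (\<lambda>x. \<Sum>\<alpha> | (\<Sum>i\<in>UNIV. \<alpha> i) \<le> k. e \<alpha> * (\<Prod>i\<in>UNIV. (x $ i) ^ \<alpha> i))"
    using assms unfolding poly_space_def by blast
  then show ?thesis
    unfolding poly_space_def
    by (auto simp: algebra_simps sum.distrib sum_distrib_left intro!: exI[of _ "\<lambda>\<alpha>. c * d \<alpha> + e \<alpha>"])
qed

lemma V_h_lincomb:
  assumes "open \<Omega>" "bounded \<Omega>" "u \<in> V_h \<Omega> \<T> k" "v \<in> V_h \<Omega> \<T> k"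
  shows "(\<lambda>x. c * u x + v x) \<in> V_h \<Omega> \<T> k"
proof -
  have "\<exists>p\<in>poly_space k. \<forall>x\<in>T. c * u x + v x = p x" if T: "T \<in> \<T>" for T
  proof -
    obtain p q where "p \<in> poly_space k" "\<forall>x\<in>T. u x = p x" "q \<in> poly_space k" "\<forall>x\<in>T. v x = q x"
      using assms(3,4) T unfolding V_h_def by blast
    then show ?thesis by (intro bexI[OF _ poly_space_lincomb[of p k q c]]) auto
  qed
  then show ?thesis
    using assms by (auto simp: V_h_def H1_space_lincomb intro!: continuous_intros)
qed

lemma zero_in_V_h: "(\<lambda>_. 0) \<in> V_h \<Omega> \<T> k"
proof -
  have "(\<lambda>_. 0) \<in> poly_space k" unfolding poly_space_def by (auto intro!: exI[of _ "\<lambda>_. 0"])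
  moreover have "is_weak_grad \<Omega> (\<lambda>_. 0) (\<lambda>_. 0)"
    by (simp add: is_weak_grad_def L2_space_def L2_inner_def)
  ultimately show ?thesis by (auto simp: V_h_def H1_space_def L2_space_def)
qed

lemma finite_multi_indices: "finite {\<alpha> :: 'd::finite \<Rightarrow> nat. (\<Sum>i\<in>UNIV. \<alpha> i) \<le> k}"
proof (rule finite_subset)
  show "{\<alpha> :: 'd \<Rightarrow> nat. (\<Sum>i\<in>UNIV. \<alpha> i) \<le> k} \<subseteq> {\<alpha>. \<alpha> ` UNIV \<subseteq> {..k} \<and> (\<forall>i. i \<notin> UNIV \<longrightarrow> \<alpha> i = 0)}"
    by (auto intro: order_trans[OF member_le_sum[of _ UNIV]])
  show "finite {\<alpha> :: 'd \<Rightarrow> nat. \<alpha> ` UNIV \<subseteq> {..k} \<and> (\<forall>i. i \<notin> UNIV \<longrightarrow> \<alpha> i = 0)}"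
    using finite_set_of_finite_funs[of "UNIV :: 'd set" "{..k}" 0] by (simp add: image_subset_iff)
qed

text \<open>Real functions form an abelian group pointwise; this scalar multiplication makes them a vector
space, so that spans and independent sets are available for sets of functions.\<close>

definition fun_scale :: "real \<Rightarrow> ('a \<Rightarrow> real) \<Rightarrow> 'a \<Rightarrow> real" where
  "fun_scale c f = (\<lambda>x. c * f x)"

interpretation fun_space: vector_space fun_scale
  by unfold_locales (auto simp: fun_scale_def algebra_simps)

lemma fun_lincomb: "fun_scale c f + g = (\<lambda>x. c * f x + g x)"
  by (auto simp: fun_scale_def)

lemma sum_fun_apply: "(\<Sum>i\<in>J. f i) x = (\<Sum>i\<in>J. f i x :: real)"
  by (induction J rule: infinite_finite_induct) auto

lemma V_h_subspace:
  assumes "open \<Omega>" "bounded \<Omega>"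
  shows "fun_space.subspace (V_h \<Omega> \<T> k)"
proof (rule fun_space.subspaceI)
  show zero: "0 \<in> V_h \<Omega> \<T> k" using zero_in_V_h[of \<Omega> \<T> k] by (simp add: zero_fun_def)
  fix u v c assume u: "u \<in> V_h \<Omega> \<T> k"
  show "fun_scale c u \<in> V_h \<Omega> \<T> k"
    using V_h_lincomb[OF assms u zero, of c] by (simp add: fun_scale_def)
  assume v: "v \<in> V_h \<Omega> \<T> k"
  show "u + v \<in> V_h \<Omega> \<T> k"
    using V_h_lincomb[OF assms u v, of 1] by (simp add: plus_fun_def)
qed

text \<open>Neighbouring cells share faces, so each point \<open>x\<close> of the closure is assigned one cell \<open>\<tau> x\<close> that contains it.
The monomials cut off to the fibres of \<open>\<tau>\<close> are finitely many functions whose span contains \<open>V_h\<close>.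
They need not be elements of \<open>V_h\<close>, being discontinuous in general; a maximal independent subset
of \<open>V_h\<close> is a basis, and it is finite because it lies in a finitely generated space.\<close>

lemma V_h_finite_span:
  fixes \<Omega> :: "(real ^ 'd) set"
  assumes \<Omega>: "open \<Omega>" "bounded \<Omega>" and fin: "finite \<T>" and cover: "closure \<Omega> \<subseteq> \<Union>\<T>"
  obtains B where "finite B" "fun_space.span B = V_h \<Omega> \<T> k"
proof -
  define \<tau> where "\<tau> x = (SOME T. T \<in> \<T> \<and> x \<in> T)" for x
  have \<tau>: "\<tau> x \<in> \<T>" "x \<in> \<tau> x" if "x \<in> closure \<Omega>" for x
    using someI_ex[of "\<lambda>T. T \<in> \<T> \<and> x \<in> T"] cover that unfolding \<tau>_def by blast+
  define N where "N = {\<alpha> :: 'd \<Rightarrow> nat. (\<Sum>i\<in>UNIV. \<alpha> i) \<le> k}"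
  define e where "e = (\<lambda>(T, \<alpha>) x. if x \<in> closure \<Omega> \<and> \<tau> x = T then \<Prod>i\<in>UNIV. (x $ i) ^ \<alpha> i else 0 :: real)"
  have finE: "finite (e ` (\<T> \<times> N))" using fin by (simp add: N_def finite_multi_indices)
  have sub: "V_h \<Omega> \<T> k \<subseteq> fun_space.span (e ` (\<T> \<times> N))"
  proof
    fix v assume v: "v \<in> V_h \<Omega> \<T> k"
    have "\<exists>c. \<forall>x\<in>T. v x = (\<Sum>\<alpha>\<in>N. c \<alpha> * (\<Prod>i\<in>UNIV. (x $ i) ^ \<alpha> i))" if "T \<in> \<T>" for T
      using v that unfolding V_h_def poly_space_def N_def by blast
    then obtain c where c: "\<And>T x. T \<in> \<T> \<Longrightarrow> x \<in> T \<Longrightarrow>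
         v x = (\<Sum>\<alpha>\<in>N. c T \<alpha> * (\<Prod>i\<in>UNIV. (x $ i) ^ \<alpha> i))" by metis
    have "v x = (\<Sum>T\<in>\<T>. \<Sum>\<alpha>\<in>N. c T \<alpha> * e (T, \<alpha>) x)" for x
    proof (cases "x \<in> closure \<Omega>")
      case True
      have "(\<Sum>T\<in>\<T>. \<Sum>\<alpha>\<in>N. c T \<alpha> * e (T, \<alpha>) x) = (\<Sum>T\<in>\<T>. if \<tau> x = T then v x else 0)"
        using True c \<tau>[OF True] by (intro sum.cong) (auto simp: e_def)
      then show ?thesis using \<tau>(1)[OF True] fin by simp
    next
      case False
      then show ?thesis using v by (simp add: e_def V_h_def)
    qed
    then have "v = (\<Sum>T\<in>\<T>. \<Sum>\<alpha>\<in>N. fun_scale (c T \<alpha>) (e (T, \<alpha>)))"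
      by (auto simp: fun_scale_def fun_eq_iff sum_fun_apply)
    moreover have "\<dots> \<in> fun_space.span (e ` (\<T> \<times> N))"
      by (intro fun_space.span_sum fun_space.span_scale fun_space.span_base) auto
    ultimately show "v \<in> fun_space.span (e ` (\<T> \<times> N))" by simp
  qed
  obtain B where B: "B \<subseteq> V_h \<Omega> \<T> k" "fun_space.independent B" "V_h \<Omega> \<T> k \<subseteq> fun_space.span B"
    using fun_space.maximal_independent_subset .
  have "finite B" using fun_space.independent_span_bound[OF finE B(2)] B(1) sub by blast
  moreover have "fun_space.span B = V_h \<Omega> \<T> k"
    using fun_space.span_subspace[OF B(1,3) V_h_subspace[OF \<Omega>]] .
  ultimately show ?thesis using that by blast
qed

lemma V_h_L2_inner_zero_imp_zero:
  assumes \<Omega>: "open \<Omega>" "bounded \<Omega>" and v: "v \<in> V_h \<Omega> \<T> k" and zero: "L2_inner \<Omega> v v = 0"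
  shows "v = (\<lambda>_. 0)"
proof -
  have cont: "continuous_on (closure \<Omega>) v" and out: "\<And>x. x \<notin> closure \<Omega> \<Longrightarrow> v x = 0"
    using v by (auto simp: V_h_def)
  have L2: "v \<in> L2_space \<Omega>" using v by (simp add: V_h_def H1_space_def)
  have "AE x in lebesgue_on \<Omega>. v x * v x = 0"
    using zero integral_nonneg_eq_0_iff_AE[OF L2_space_mult_integrable[OF L2 L2]] by (simp add: L2_inner_def)
  then have "AE x in lebesgue. x \<in> \<Omega> \<longrightarrow> v x = 0"
    using \<Omega> by (simp add: AE_restrict_space_iff)
  then have "AE x in lebesgue. x \<notin> \<Omega> \<inter> v -` (- {0})"
    by (rule eventually_mono) blast
  moreover have op: "open (\<Omega> \<inter> v -` (- {0}))"
    using \<Omega>(1) cont closure_subset by (intro continuous_open_preimage) (auto intro: continuous_on_subset)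
  moreover have "\<Omega> \<inter> v -` (- {0}) \<in> sets lebesgue" using op by auto
  ultimately have "negligible (\<Omega> \<inter> v -` (- {0}))"
    by (simp add: negligible_iff_null_sets AE_iff_null_sets)
  with op have "\<Omega> \<inter> v -` (- {0}) = {}" using open_not_negligible by blast
  then have "v x = 0" if "x \<in> closure \<Omega>" for x
    using continuous_constant_on_closure[OF cont, of 0] that by blast
  with out show ?thesis by blast
qed

section \<open>One time step in abstract form\<close>

definition (in vector_space) symmetric_bilinear_on :: "'b set \<Rightarrow> ('b \<Rightarrow> 'b \<Rightarrow> 'a) \<Rightarrow> bool" where
  "symmetric_bilinear_on V a \<longleftrightarrow> (\<forall>u\<in>V. \<forall>v\<in>V. a u v = a v u) \<and>
     (\<forall>c. \<forall>u\<in>V. \<forall>v\<in>V. \<forall>w\<in>V. a (scale c u + v) w = c * a u w + a v w)"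

context vector_space
begin

context
  fixes V a
  assumes a: "symmetric_bilinear_on V a" and V: "subspace V"
begin

lemma symmetric_bilinear_on_commute: "u \<in> V \<Longrightarrow> v \<in> V \<Longrightarrow> a u v = a v u"
  using a unfolding symmetric_bilinear_on_def by blast

lemma symmetric_bilinear_on_left:
  "u \<in> V \<Longrightarrow> v \<in> V \<Longrightarrow> w \<in> V \<Longrightarrow> a (scale c u + v) w = c * a u w + a v w"
  using a unfolding symmetric_bilinear_on_def by blast

lemma symmetric_bilinear_on_right:
  "u \<in> V \<Longrightarrow> v \<in> V \<Longrightarrow> w \<in> V \<Longrightarrow> a w (scale c u + v) = c * a w u + a w v"
  using symmetric_bilinear_on_left symmetric_bilinear_on_commute V
  by (metis subspace_add subspace_scale)

lemma symmetric_bilinear_on_diff: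
  assumes "u \<in> V" "v \<in> V" "w \<in> V"
  shows "a (u - v) w = a u w - a v w" "a w (u - v) = a w u - a w v"
  using symmetric_bilinear_on_left[of v u w "- 1"] symmetric_bilinear_on_right[of v u w "- 1"] assms
  by simp_all

lemma symmetric_bilinear_on_zero:
  assumes "w \<in> V"
  shows "a 0 w = 0" "a w 0 = 0"
  using symmetric_bilinear_on_diff[of w w w] assms by simp_all

end

end

text \<open>The scheme with everything concrete removed: \<open>m\<close> is the mass form, \<open>s\<close> the stiffness form, and \<open>g\<close>
the coupling \<open>(u, \<psi>) \<mapsto> (h u, \<psi>)\<close>. Symmetry of \<open>g\<close> is what makes the coupling terms of the
two equations cancel.\<close>

locale relaxed_step = vector_space scale
  for scale :: "real \<Rightarrow> 'v::ab_group_add \<Rightarrow> 'v" +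
  fixes B :: "'v set" and m s g :: "'v \<Rightarrow> 'v \<Rightarrow> real" and \<tau> :: real
  assumes finite_B: "finite B"
    and m: "symmetric_bilinear_on (span B) m"
    and s: "symmetric_bilinear_on (span B) s"
    and g: "symmetric_bilinear_on (span B) g"
    and m_nonneg: "\<And>v. v \<in> span B \<Longrightarrow> 0 \<le> m v v"
    and m_definite: "\<And>v. v \<in> span B \<Longrightarrow> m v v = 0 \<Longrightarrow> v = 0"
    and s_nonneg: "\<And>v. v \<in> span B \<Longrightarrow> 0 \<le> s v v"
    and \<tau>_pos: "0 < \<tau>"
begin

lemmas bilin_left = symmetric_bilinear_on_left[OF _ subspace_span[of B]]
lemmas bilin_right = symmetric_bilinear_on_right[OF _ subspace_span[of B]]
lemmas bilin_diff = symmetric_bilinear_on_diff[OF _ subspace_span[of B]]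
lemmas bilin_zero = symmetric_bilinear_on_zero[OF _ subspace_span[of B]]
lemmas bilin_comm = symmetric_bilinear_on_commute[OF _ subspace_span[of B]]

text \<open>The time step has been cancelled from the second equation, where it divides both sides.\<close>

definition step :: "'v \<Rightarrow> 'v \<Rightarrow> 'v \<Rightarrow> 'v \<Rightarrow> bool" where
  "step u0 U0 u U \<longleftrightarrow> u \<in> span B \<and> U \<in> span B \<and>
     (\<forall>\<phi>\<in>span B. m (u - u0) \<phi> / \<tau> = - s u \<phi> - g U \<phi>) \<and>
     (\<forall>\<psi>\<in>span B. m (U - U0) \<psi> = 1/2 * g (u - u0) \<psi>)"

text \<open>The product space is spanned by \<open>B \<times> {0} \<union> {0} \<times> B\<close>. The second equation enters with the factor 2, so that
on the diagonal \<open>g U u - g u U = 0\<close>.\<close>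

lemma step_unique:
  assumes u0: "u0 \<in> span B" and U0: "U0 \<in> span B"
  shows "\<exists>!(u, U). step u0 U0 u U"
proof -
  interpret P: vector_space_prod scale scale ..
  define C where "C = B \<times> {0} \<union> {0} \<times> B"
  have C: "P.p.span C = span B \<times> span B"
    unfolding C_def P.p.span_Un P.span_Times_sing1 P.span_Times_sing2 by force
  define a where "a = (\<lambda>(u, U) (\<phi>, \<psi>). m u \<phi> / \<tau> + s u \<phi> + g U \<phi> + 2 * m U \<psi> - g u \<psi>)"
  define l where "l = (\<lambda>(\<phi>, \<psi>). m u0 \<phi> / \<tau> + 2 * m U0 \<psi> - g u0 \<psi>)"
  have "\<exists>!w. w \<in> P.p.span C \<and> (\<forall>v\<in>P.p.span C. a w v = l v)"
  proof (rule P.p.galerkin_unique_solution)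
    show "finite C" using finite_B by (simp add: C_def)
    show "v = 0" if v_span: "v \<in> P.p.span C" and "a v v = 0" for v
    proof -
      obtain u U where v: "v = (u, U)" "u \<in> span B" "U \<in> span B"
        using v_span unfolding C by blast
      have "m u u / \<tau> + s u u + 2 * m U U = 0"
        using that(2) v bilin_comm[OF g, of u U] by (simp add: a_def)
      moreover have "0 \<le> m u u / \<tau>" "0 \<le> s u u" "0 \<le> m U U"
        using v m_nonneg s_nonneg \<tau>_pos by auto
      ultimately have "m u u / \<tau> = 0" "m U U = 0" by linarith+
      then show ?thesis using v m_definite \<tau>_pos by (simp add: zero_prod_def)
    qed
    show "a (P.scale c u + v) w = c * a u w + a v w"
      if "u \<in> P.p.span C" "v \<in> P.p.span C" "w \<in> P.p.span C" for c u v w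
      using that unfolding C
      by (clarsimp simp: a_def P.scale_prod bilin_left[OF m] bilin_left[OF s] bilin_left[OF g])
         (simp add: algebra_simps add_divide_distrib)
    show "a w (P.scale c u + v) = c * a w u + a w v"
      if "u \<in> P.p.span C" "v \<in> P.p.span C" "w \<in> P.p.span C" for c u v w
      using that unfolding C
      by (clarsimp simp: a_def P.scale_prod bilin_right[OF m] bilin_right[OF s] bilin_right[OF g])
         (simp add: algebra_simps add_divide_distrib)
    show "l (P.scale c u + v) = c * l u + l v"
      if "u \<in> P.p.span C" "v \<in> P.p.span C" for c u v
      using that u0 U0 unfolding C
      by (clarsimp simp: l_def P.scale_prod bilin_right[OF m] bilin_right[OF g])
         (simp add: algebra_simps add_divide_distrib)
  qed
  moreover have "step u0 U0 u U \<longleftrightarrow> (u, U) \<in> P.p.span C \<and> (\<forall>v\<in>P.p.span C. a (u, U) v = l v)" for u U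
  proof (cases "u \<in> span B \<and> U \<in> span B")
    case True
    then have uU: "u \<in> span B" "U \<in> span B" by auto
    have eq: "a (u, U) (\<phi>, \<psi>) - l (\<phi>, \<psi>) = (m (u - u0) \<phi> / \<tau> + s u \<phi> + g U \<phi>)
          + 2 * (m (U - U0) \<psi> - 1/2 * g (u - u0) \<psi>)"
      if "\<phi> \<in> span B" "\<psi> \<in> span B" for \<phi> \<psi>
      using that uU u0 U0
      by (simp add: a_def l_def bilin_diff[OF m] bilin_diff[OF g] diff_divide_distrib algebra_simps)
    have d: "u - u0 \<in> span B" "U - U0 \<in> span B" using uU u0 U0 by (auto intro: span_diff)
    \<comment> \<open>the two equations are recovered by setting one of the test functions to zero\<close>
    have eq1: "a (u, U) (\<phi>, 0) - l (\<phi>, 0) = m (u - u0) \<phi> / \<tau> + s u \<phi> + g U \<phi>" if "\<phi> \<in> span B" for \<phi>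
      using eq[OF that span_zero] d by (simp add: bilin_zero[OF m] bilin_zero[OF g])
    have eq2: "a (u, U) (0, \<psi>) - l (0, \<psi>) = 2 * (m (U - U0) \<psi> - 1/2 * g (u - u0) \<psi>)" if "\<psi> \<in> span B" for \<psi>
      using eq[OF span_zero that] d uU by (simp add: bilin_zero[OF m] bilin_zero[OF s] bilin_zero[OF g])
    show ?thesis
    proof
      assume st: "step u0 U0 u U"
      have "a (u, U) (\<phi>, \<psi>) = l (\<phi>, \<psi>)" if "\<phi> \<in> span B" "\<psi> \<in> span B" for \<phi> \<psi>
      proof -
        have "m (u - u0) \<phi> / \<tau> = - s u \<phi> - g U \<phi>" "m (U - U0) \<psi> = 1/2 * g (u - u0) \<psi>"
          using st that unfolding step_def by blast+
        then show ?thesis using eq[OF that] by simp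
      qed
      then show "(u, U) \<in> P.p.span C \<and> (\<forall>v\<in>P.p.span C. a (u, U) v = l v)"
        using uU by (auto simp: C)
    next
      assume "(u, U) \<in> P.p.span C \<and> (\<forall>v\<in>P.p.span C. a (u, U) v = l v)"
      then have al: "a (u, U) (\<phi>, \<psi>) = l (\<phi>, \<psi>)" if "\<phi> \<in> span B" "\<psi> \<in> span B" for \<phi> \<psi>
        using that by (auto simp: C)
      have "m (u - u0) \<phi> / \<tau> = - s u \<phi> - g U \<phi>" if "\<phi> \<in> span B" for \<phi>
        using eq1[OF that] al[OF that span_zero] by simp
      moreover have "m (U - U0) \<psi> = 1/2 * g (u - u0) \<psi>" if "\<psi> \<in> span B" for \<psi>
        using eq2[OF that] al[OF span_zero that] by simp
      ultimately show "step u0 U0 u U" using uU unfolding step_def by blast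
    qed
  next
    case False
    then show ?thesis by (auto simp: step_def C)
  qed
  ultimately show ?thesis by (simp add: case_prod_unfold)
qed

lemma polarization:
  assumes a: "symmetric_bilinear_on (span B) a" and "u \<in> span B" "v \<in> span B"
  shows "2 * a u (u - v) = a u u - a v v + a (u - v) (u - v)"
proof -
  have "u - v \<in> span B" using assms by (simp add: span_diff)
  then show ?thesis using assms bilin_comm[OF a, of u v] by (simp add: bilin_diff[OF a])
qed

text \<open>The first equation is tested with \<open>u - u0\<close>, the second with the new iterate \<open>U\<close>; twice the second
then cancels the coupling term of the first.\<close>

lemma step_energy_law:
  assumes st: "step u0 U0 u U" and u0: "u0 \<in> span B" and U0: "U0 \<in> span B"
  shows "1/2 * s u u + m U U = 1/2 * s u0 u0 + m U0 U0
     - 1 / \<tau> * m (u - u0) (u - u0) - 1/2 * s (u - u0) (u - u0) - m (U - U0) (U - U0)"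
proof -
  have uU: "u \<in> span B" "U \<in> span B" using st by (auto simp: step_def)
  have d: "u - u0 \<in> span B" "U - U0 \<in> span B" using uU u0 U0 by (auto intro: span_diff)
  have "m (u - u0) (u - u0) / \<tau> = - s u (u - u0) - g U (u - u0)"
    using st d by (simp add: step_def)
  moreover have "m (U - U0) U = 1/2 * g (u - u0) U"
    using st uU by (simp add: step_def)
  moreover have "g U (u - u0) = g (u - u0) U" "m (U - U0) U = m U (U - U0)"
    using bilin_comm g m uU d by blast+
  ultimately show ?thesis
    using polarization[OF s uU(1) u0] polarization[OF m uU(2) U0] by simp
qed

end

section \<open>The finite element scheme\<close>

lemma V_h_L2_space: "v \<in> V_h \<Omega> \<T> k \<Longrightarrow> v \<in> L2_space \<Omega>"
  by (simp add: V_h_def H1_space_def)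

lemma V_h_continuous_mult_L2_space:
  assumes "open \<Omega>" "bounded \<Omega>" "continuous_on (closure \<Omega>) h" "v \<in> V_h \<Omega> \<T> k"
  shows "(\<lambda>x. h x * v x) \<in> L2_space \<Omega>"
  using assms by (intro continuous_on_closure_imp_L2_space) (auto simp: V_h_def intro: continuous_intros)

lemma continuous_on_H_fun_compose:
  assumes F: "\<And>s. s \<in> I \<Longrightarrow> (F has_real_derivative F' s) (at s within I)"
    and F': "continuous_on I F'" and u: "continuous_on S u"
    and range: "\<And>x. x \<in> S \<Longrightarrow> u x \<in> I \<and> F (u x) + B > 0"
  shows "continuous_on S (\<lambda>x. H_fun F F' B (u x))"
proof -
  have sub: "u ` S \<subseteq> I" using range by auto
  have "continuous_on I F" using F by (rule DERIV_continuous_on)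
  then have "continuous_on S (\<lambda>x. F (u x))" "continuous_on S (\<lambda>x. F' (u x))"
    using continuous_on_compose2[OF _ u sub] F' by blast+
  then show ?thesis
    unfolding H_fun_def using range by (intro continuous_intros) force+
qed

lemma fun_space_symmetric_bilinear_onI:
  assumes "\<And>u v. u \<in> V \<Longrightarrow> v \<in> V \<Longrightarrow> a u v = a v u"
    and "\<And>c u v w. u \<in> V \<Longrightarrow> v \<in> V \<Longrightarrow> w \<in> V \<Longrightarrow> a (\<lambda>x. c * u x + v x) w = c * a u w + a v w"
  shows "fun_space.symmetric_bilinear_on V a"
  using assms by (simp add: fun_space.symmetric_bilinear_on_def fun_lincomb)

theorem lemma3p2:
  fixes \<Omega> :: "(real ^ 'd) set" and \<T> :: "(real ^ 'd) set set"
    and k :: nat and \<epsilon> \<Delta>t B \<rho> :: real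
    and F F' :: "real \<Rightarrow> real" and I :: "real set"
    and u0 U0 :: "real ^ 'd \<Rightarrow> real"
  assumes "CARD('d) \<in> {2, 3}"
    and "open \<Omega>" and "connected \<Omega>" and "\<Omega> \<noteq> {}" and "bounded \<Omega>"
    and "mesh_of \<Omega> \<T>" and "quasi_uniform \<rho> \<T>"
    and "k \<ge> 1" and "\<epsilon> > 0" and "\<Delta>t > 0" and "B \<ge> 0"
    and "is_interval I"
    and "\<And>s. s \<in> I \<Longrightarrow> (F has_real_derivative F' s) (at s within I)"
    and "continuous_on I F'"
    and "u0 \<in> V_h \<Omega> \<T> k" and "U0 \<in> V_h \<Omega> \<T> k"
    and "\<And>x. x \<in> closure \<Omega> \<Longrightarrow> u0 x \<in> I \<and> F (u0 x) + B > 0"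
  shows "(\<exists>!(u, U). scheme_solution \<Omega> (V_h \<Omega> \<T> k) \<epsilon> \<Delta>t (\<lambda>x. H_fun F F' B (u0 x)) u0 U0 u U) \<and>
    (\<forall>u U. scheme_solution \<Omega> (V_h \<Omega> \<T> k) \<epsilon> \<Delta>t (\<lambda>x. H_fun F F' B (u0 x)) u0 U0 u U \<longrightarrow>
       energy \<Omega> \<epsilon> B u U = energy \<Omega> \<epsilon> B u0 U0
         - 1 / \<Delta>t * (L2_norm \<Omega> (\<lambda>x. u x - u0 x))\<^sup>2
         - 1/2 * A_form \<Omega> (\<lambda>_. \<epsilon>\<^sup>2) (\<lambda>x. u x - u0 x) (\<lambda>x. u x - u0 x)
         - (L2_norm \<Omega> (\<lambda>x. U x - U0 x))\<^sup>2)"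
proof -
  note \<Omega> = \<open>open \<Omega>\<close> \<open>bounded \<Omega>\<close>
  define h where "h = (\<lambda>x. H_fun F F' B (u0 x))"
  define g where "g = (\<lambda>v w. L2_inner \<Omega> (\<lambda>x. h x * v x) w)"
  have "continuous_on (closure \<Omega>) u0" using \<open>u0 \<in> V_h \<Omega> \<T> k\<close> by (simp add: V_h_def)
  then have "continuous_on (closure \<Omega>) h"
    unfolding h_def using continuous_on_H_fun_compose assms(13,14,17) by blast
  note hv = V_h_continuous_mult_L2_space[OF \<Omega> this]
  have "finite \<T>" "closure \<Omega> \<subseteq> \<Union>\<T>"
    using \<open>mesh_of \<Omega> \<T>\<close> by (auto simp: mesh_of_def triangulation_def)
  from V_h_finite_span[OF \<Omega> this] obtain E
    where E: "finite E" and span: "fun_space.span E = V_h \<Omega> \<T> k" .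
  have H1: "v \<in> H1_space \<Omega>" if "v \<in> V_h \<Omega> \<T> k" for v using that by (simp add: V_h_def)
  interpret relaxed_step fun_scale E "L2_inner \<Omega>" "A_form \<Omega> (\<lambda>_. \<epsilon>\<^sup>2)" g \<Delta>t
  proof (unfold_locales, unfold span)
    show "fun_space.symmetric_bilinear_on (V_h \<Omega> \<T> k) (L2_inner \<Omega>)"
      by (intro fun_space_symmetric_bilinear_onI L2_inner_commute L2_inner_lincomb V_h_L2_space)
    show "fun_space.symmetric_bilinear_on (V_h \<Omega> \<T> k) (A_form \<Omega> (\<lambda>_. \<epsilon>\<^sup>2))"
      by (intro fun_space_symmetric_bilinear_onI A_form_commute A_form_lincomb \<Omega> H1)
    show "fun_space.symmetric_bilinear_on (V_h \<Omega> \<T> k) g"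
    proof (rule fun_space_symmetric_bilinear_onI)
      show "g u v = g v u" for u v
        by (simp add: g_def L2_inner_def mult.assoc mult.left_commute mult.commute)
      show "g (\<lambda>x. c * u x + v x) w = c * g u w + g v w"
        if "u \<in> V_h \<Omega> \<T> k" "v \<in> V_h \<Omega> \<T> k" "w \<in> V_h \<Omega> \<T> k" for c u v w
        using L2_inner_lincomb[OF hv[OF that(1)] hv[OF that(2)] V_h_L2_space[OF that(3)], of c]
        by (simp add: g_def algebra_simps)
    qed
    show "v = 0" if "v \<in> V_h \<Omega> \<T> k" "L2_inner \<Omega> v v = 0" for v
      using V_h_L2_inner_zero_imp_zero[OF \<Omega> that] by (simp add: zero_fun_def)
  qed (use E \<open>\<Delta>t > 0\<close> in \<open>auto intro: L2_inner_nonneg A_form_nonneg\<close>)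
  have scheme: "scheme_solution \<Omega> (V_h \<Omega> \<T> k) \<epsilon> \<Delta>t h u0 U0 u U \<longleftrightarrow> step u0 U0 u U" for u U
  proof -
    have "L2_inner \<Omega> (\<lambda>x. (v x - w x) / \<Delta>t) \<phi> = L2_inner \<Omega> (v - w) \<phi> / \<Delta>t" for v w \<phi>
      by (simp add: L2_inner_def)
    moreover have "L2_inner \<Omega> (\<lambda>x. 1/2 * h x * ((u x - u0 x) / \<Delta>t)) \<psi> = 1/2 * g (u - u0) \<psi> / \<Delta>t" for \<psi>
    proof -
      have "(\<lambda>x. 1/2 * h x * ((u x - u0 x) / \<Delta>t) * \<psi> x) = (\<lambda>x. (1/2 / \<Delta>t) * (h x * (u - u0) x * \<psi> x))"
        by (auto simp: field_simps)
      then show ?thesis by (simp only: L2_inner_def g_def integral_mult_right_zero) simp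
    qed
    moreover have "a / \<Delta>t = b / \<Delta>t \<longleftrightarrow> a = b" for a b using \<open>\<Delta>t > 0\<close> by simp
    ultimately show ?thesis
      unfolding scheme_solution_def step_def span by (simp only: g_def)
  qed
  have u0U0: "u0 \<in> fun_space.span E" "U0 \<in> fun_space.span E" using assms span by auto
  have energy: "energy \<Omega> \<epsilon> B v W = 1/2 * A_form \<Omega> (\<lambda>_. \<epsilon>\<^sup>2) v v + L2_inner \<Omega> W W - B * measure lebesgue \<Omega>" for v W
    by (simp add: energy_def L2_inner_def power2_eq_square)
  have norm: "(L2_norm \<Omega> (\<lambda>x. v x - w x))\<^sup>2 = L2_inner \<Omega> (v - w) (v - w)" for v w
    by (simp add: L2_norm_def L2_inner_nonneg fun_diff_def)
  have "\<exists>!(u, U). scheme_solution \<Omega> (V_h \<Omega> \<T> k) \<epsilon> \<Delta>t h u0 U0 u U"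
    using step_unique[OF u0U0] by (simp add: scheme)
  moreover have "energy \<Omega> \<epsilon> B u U = energy \<Omega> \<epsilon> B u0 U0
         - 1 / \<Delta>t * (L2_norm \<Omega> (\<lambda>x. u x - u0 x))\<^sup>2
         - 1/2 * A_form \<Omega> (\<lambda>_. \<epsilon>\<^sup>2) (\<lambda>x. u x - u0 x) (\<lambda>x. u x - u0 x)
         - (L2_norm \<Omega> (\<lambda>x. U x - U0 x))\<^sup>2"
    if "scheme_solution \<Omega> (V_h \<Omega> \<T> k) \<epsilon> \<Delta>t h u0 U0 u U" for u U
    using step_energy_law[OF _ u0U0, of u U] that unfolding energy norm scheme
    by (simp add: fun_diff_def)
  ultimately show ?thesis unfolding h_def by blast
qed

end
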